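(* Let $\ell,r_0,\ldots,r_{\ell-1}$ be positive integers with $q-1=\ell s$. Suppose $q=q_0^m$ where $q_0\equiv 1\pmod{\ell}$ and $\ell\mid m$. Let $f_0(x),\ldots,f_{\ell-1}(x)$ be polynomials in $\mathbb{F}_{q_0}[x]$ and define $P:\mathbb{F}_q\to\mathbb{F}_q$ by $P(0)=0$ and $P(x)=x^{r_i}f_i(x^s)$ if $x\in C_i$, for $0\le i\le\ell-1$. Then $P(x)$ is a permutation polynomial of $\mathbb{F}_q$ if and only if $\{r_ii\mid i=0,\ldots,\ell-1\}$ is a complete set of residues modulo $\ell$, and $\gcd(r_i,s)=1$ and $f_i(\zeta^i)\neq 0$ for all $0\le i\le\ell-1$.
   Context: $q_0$ and $q$ are prime powers and $m$ is a positive integer. $\gamma$ is a fixed primitive element (generator of $\mathbb{F}_q^*$). $C_0=\{\gamma^{\ell j}: 0\le j\le s-1\}$ and $C_i=\gamma^iC_0$ for $0\le i\le\ell-1$ are the cyclotomic cosets. $\zeta=\gamma^s$ is a primitive $\ell$-th root of unity. A map (or polynomial) is a permutation polynomial (PP) of $\mathbb{F}_q$ if it induces a bijection of $\mathbb{F}_q$. *)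

theory Defs
  imports
    "HOL-Computational_Algebra.Polynomial"
    "HOL-Library.Cardinality"
    "HOL-Number_Theory.Cong"
    "HOL-Number_Theory.Prime_Powers"
begin

text \<open>
  The field with \<open>q\<close> elements is a type \<open>'a\<close> of classes \<open>field\<close> and \<open>finite\<close> with
  \<open>CARD('a) = q\<close>. When \<open>q\<close> is a power of \<open>q0\<close>, the field with \<open>q0\<close> elements is the (unique)
  subfield of \<open>'a\<close> having \<open>q0\<close> elements, and the polynomials over it are the elements of
  \<open>'a poly\<close> with all coefficients in that subfield.
\<close>

definition is_subfield :: "'a::field set \<Rightarrow> bool" where
  "is_subfield K \<longleftrightarrow>
     0 \<in> K \<and> 1 \<in> K \<and>
     (\<forall>x\<in>K. \<forall>y\<in>K. x + y \<in> K \<and> x * y \<in> K) \<and>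
     (\<forall>x\<in>K. - x \<in> K \<and> inverse x \<in> K)"

text \<open>
  The equation below excludes \<open>\<gamma> = 0\<close>, because \<open>0 powi 1 = 0\<close>.
\<close>

definition is_primitive_element :: "'a::field \<Rightarrow> bool" where
  "is_primitive_element \<gamma> \<longleftrightarrow> range (\<lambda>k::int. \<gamma> powi k) = UNIV - {0}"

definition cyclotomic_coset :: "'a::field \<Rightarrow> nat \<Rightarrow> nat \<Rightarrow> nat \<Rightarrow> 'a set" where
  "cyclotomic_coset \<gamma> l s i = (\<lambda>c. \<gamma> ^ i * c) ` {\<gamma> ^ (l * j) |j. j < s}"

text \<open>
  Uniqueness of the representative is part of the notion, so a complete set of residues
  modulo \<open>l\<close> has exactly \<open>l\<close> elements.
\<close>

definition complete_residue_set :: "nat \<Rightarrow> nat set \<Rightarrow> bool" where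
  "complete_residue_set l A \<longleftrightarrow> (\<forall>a::int. \<exists>!x. x \<in> A \<and> [a = int x] (mod int l))"

end

theory Submission imports Defs begin

text \<open>
  The coset \<open>C\<^sub>i\<close> consists of the nonzero \<open>x\<close> with \<open>x\<^sup>s = \<zeta>\<^sup>i\<close>, so \<open>P\<close> acts on it as
  \<open>x \<mapsto> a\<^sub>i x ^ r\<^sub>i\<close> with the constant \<open>a\<^sub>i = f\<^sub>i(\<zeta>\<^sup>i)\<close>. Since \<open>l\<close> divides \<open>q\<^sub>0 - 1\<close>, the root of
  unity \<open>\<zeta>\<close>, and with it \<open>a\<^sub>i\<close>, lies in the subfield \<open>K\<close>. Moreover \<open>q\<^sub>0 - 1\<close> divides
  \<open>s = (q - 1) / l\<close>, because \<open>(q - 1) / (q\<^sub>0 - 1) = 1 + q\<^sub>0 + \<dots> + q\<^sub>0 ^ (m - 1)\<close> is congruent to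
  \<open>m\<close>, hence to \<open>0\<close>, modulo \<open>l\<close>. So \<open>a\<^sub>i\<^sup>s = 1\<close> whenever \<open>a\<^sub>i\<close> is nonzero, and raising to
  the power \<open>s\<close> shows that \<open>P\<close> maps \<open>C\<^sub>i\<close> into the coset of index \<open>r\<^sub>i i mod l\<close>. Thus \<open>P\<close> is a
  bijection iff the cosets are permuted and \<open>x \<mapsto> x ^ r\<^sub>i\<close> is injective on each of them.
\<close>

section \<open>Element orders in finite multiplicative structures\<close>

lemma power_card_eq_1_of_mult_closed:
  fixes S :: "'a::field set"
  assumes "finite S" and "0 \<notin> S" and closed: "\<And>x y. x \<in> S \<Longrightarrow> y \<in> S \<Longrightarrow> x * y \<in> S"
    and "x \<in> S"
  shows "x ^ card S = 1"
proof -
  have "x \<noteq> 0"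
    using assms by auto
  have inj: "inj_on ((*) x) S"
    using \<open>x \<noteq> 0\<close> by (auto simp: inj_on_def)
  \<comment> \<open>Multiplication by \<open>x\<close> permutes \<open>S\<close>, so the product
    over \<open>S\<close> absorbs a factor \<open>x ^ card S\<close> and then cancels.\<close>
  have "(*) x ` S = S"
    using inj assms by (intro endo_inj_surj) auto
  then have "\<Prod>S = (\<Prod>y\<in>S. x * y)"
    using prod.reindex[OF inj, of "\<lambda>y. y"] by simp
  also have "\<dots> = x ^ card S * \<Prod>S"
    by (simp add: prod.distrib)
  finally show ?thesis
    using assms by (simp add: prod_zero_iff)
qed

text \<open>Bezout in the form \<open>a * u = b * v + 1\<close> with natural \<open>u\<close> and
  \<open>v\<close> avoids negative exponents; this form requires \<open>a > 0\<close>.\<close>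

lemma coprime_power_eq_1:
  fixes x :: "'a::monoid_mult"
  assumes "x ^ a = 1" and "x ^ b = 1" and "coprime a b" and "a > 0"
  shows "x = 1"
proof -
  obtain u v where "a * u = b * v + 1"
    using bezout_nat[of a b] assms by auto
  then have "x ^ (a * u) = x ^ (b * v) * x"
    by (simp add: power_add power_commutes)
  then show ?thesis
    by (simp add: power_mult assms)
qed

lemma nonzero_field_power_card_diff_1:
  fixes x :: "'a::{field, finite}"
  assumes "x \<noteq> 0"
  shows "x ^ (CARD('a) - 1) = 1"
  using power_card_eq_1_of_mult_closed[of "UNIV - {0}" x] assms by (simp add: card_Diff_singleton)

lemma card_field_gt_1: "CARD('a::{field, finite}) > 1"
  using card_mono[of UNIV "{0, 1::'a}"] by simp

section \<open>Discrete logarithms and cyclotomic cosets\<close>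

lemma primitive_element_nonzero: "is_primitive_element \<gamma> \<Longrightarrow> \<gamma> \<noteq> 0"
  unfolding is_primitive_element_def by (metis DiffD2 power_int_1_right rangeI singletonI)

lemma primitive_element_powers:
  fixes \<gamma> :: "'a::{field, finite}"
  assumes "is_primitive_element \<gamma>"
  shows "(^) \<gamma> ` {..<CARD('a) - 1} = UNIV - {0}"
proof
  define N where "N = CARD('a) - 1"
  have "N > 0"
    using card_field_gt_1[where 'a='a] by (simp add: N_def)
  have "\<gamma> \<noteq> 0"
    using assms by (rule primitive_element_nonzero)
  then have "\<gamma> ^ N = 1"
    unfolding N_def by (rule nonzero_field_power_card_diff_1)
  show "(^) \<gamma> ` {..<N} \<subseteq> UNIV - {0}"
    using \<open>\<gamma> \<noteq> 0\<close> by auto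
  show "UNIV - {0} \<subseteq> (^) \<gamma> ` {..<N}"
  proof
    fix x :: 'a
    assume "x \<in> UNIV - {0}"
    then obtain k where "x = \<gamma> powi k"
      using assms unfolding is_primitive_element_def by (metis (no_types, lifting) imageE)
    \<comment> \<open>Division with remainder by \<open>N\<close> turns the integer exponent into a
      natural one below \<open>N\<close>.\<close>
    also have "\<dots> = \<gamma> powi (int N * (k div int N) + k mod int N)"
      by simp
    also have "\<dots> = (\<gamma> ^ N) powi (k div int N) * \<gamma> powi (k mod int N)"
      using \<open>\<gamma> \<noteq> 0\<close> by (subst power_int_add) (simp_all add: power_int_mult)
    also have "\<dots> = \<gamma> ^ nat (k mod int N)"
      using \<open>\<gamma> ^ N = 1\<close> \<open>N > 0\<close> by (simp add: power_int_nonneg_exp)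
    finally show "x \<in> (^) \<gamma> ` {..<N}"
      using \<open>N > 0\<close> by (auto simp: nat_less_iff)
  qed
qed

text \<open>The \<open>N\<close> exponents below \<open>N\<close> cover all \<open>N\<close> nonzero
  elements, so by counting they give distinct powers; other exponents reduce modulo
  \<open>N\<close>.\<close>

lemma primitive_element_power_eq_iff:
  fixes \<gamma> :: "'a::{field, finite}"
  assumes "is_primitive_element \<gamma>"
  shows "\<gamma> ^ a = \<gamma> ^ b \<longleftrightarrow> [a = b] (mod CARD('a) - 1)"
proof -
  define N where "N = CARD('a) - 1"
  have "N > 0"
    using card_field_gt_1[where 'a='a] by (simp add: N_def)
  have "inj_on ((^) \<gamma>) {..<N}"
    by (rule eq_card_imp_inj_on)
      (simp_all only: N_def primitive_element_powers[OF assms] card_Diff_singleton UNIV_I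
        finite_lessThan card_lessThan)
  moreover have "\<gamma> ^ N = 1"
    unfolding N_def
    by (rule nonzero_field_power_card_diff_1[OF primitive_element_nonzero[OF assms]])
  then have "\<gamma> ^ n = \<gamma> ^ (n mod N)" for n
    by (metis div_mult_mod_eq mult_1 mult.commute power_add power_mult power_one)
  ultimately have "\<gamma> ^ a = \<gamma> ^ b \<longleftrightarrow> a mod N = b mod N"
    using \<open>N > 0\<close> by (metis inj_onD lessThan_iff mod_less_divisor)
  then show ?thesis
    by (simp add: N_def cong_def)
qed

text \<open>For \<open>x = \<gamma> ^ n\<close> the equation says \<open>n * s\<close> and
  \<open>i * s\<close> agree modulo \<open>l * s\<close>, that is, \<open>n mod l = i\<close>. Coset
  membership is thereby read off from \<open>x ^ s\<close>.\<close>

lemma cyclotomic_coset_iff: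
  fixes \<gamma> :: "'a::{field, finite}"
  assumes "is_primitive_element \<gamma>" and N: "CARD('a) - 1 = l * s" and "i < l"
  shows "x \<in> cyclotomic_coset \<gamma> l s i \<longleftrightarrow> x \<noteq> 0 \<and> x ^ s = (\<gamma> ^ s) ^ i"
proof
  assume "x \<in> cyclotomic_coset \<gamma> l s i"
  then obtain j where x: "x = \<gamma> ^ (i + l * j)"
    by (auto simp: cyclotomic_coset_def power_add)
  have "[(i + l * j) * s = s * i] (mod l * s)"
    by (simp add: cong_def algebra_simps mult.assoc)
  then have "x ^ s = (\<gamma> ^ s) ^ i"
    using primitive_element_power_eq_iff[OF assms(1)] N by (simp add: x flip: power_mult)
  then show "x \<noteq> 0 \<and> x ^ s = (\<gamma> ^ s) ^ i"
    using primitive_element_nonzero[OF assms(1)] by (simp add: x)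
next
  assume x: "x \<noteq> 0 \<and> x ^ s = (\<gamma> ^ s) ^ i"
  then have "x \<in> (^) \<gamma> ` {..<l * s}"
    using primitive_element_powers[OF assms(1)] N by auto
  then obtain n where n: "x = \<gamma> ^ n" "n < l * s"
    by auto
  have "s > 0"
    using n by (cases s) auto
  have "[n * s = i * s] (mod l * s)"
    using x primitive_element_power_eq_iff[OF assms(1), of "n * s" "i * s"] N
    by (simp add: n mult.commute[of i] flip: power_mult)
  then have "n mod l = i"
    using \<open>s > 0\<close> \<open>i < l\<close> by (auto simp: cong_def mult_mod_left[symmetric])
  then have "x = \<gamma> ^ i * \<gamma> ^ (l * (n div l))"
    unfolding n power_add[symmetric] by (metis mod_mult_div_eq)
  moreover have "n div l < s"
    using n by (metis less_mult_imp_div_less mult.commute)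
  ultimately show "x \<in> cyclotomic_coset \<gamma> l s i"
    unfolding cyclotomic_coset_def by blast
qed

section \<open>Residue systems as permutations of indices\<close>

lemma finite_covering_imp_bij_betw:
  assumes "finite A" and "A \<subseteq> h ` A"
  shows "bij_betw h A A"
proof -
  have "A = h ` A"
    using assms by (intro card_seteq card_image_le) auto
  then show ?thesis
    using assms(1) by (metis bij_betw_def eq_card_imp_inj_on)
qed

text \<open>Uniqueness in \<open>complete_residue_set\<close> concerns values, whereas injectivity
  here concerns indices. Existence makes the \<open>l\<close> indices cover all \<open>l\<close>
  classes, and counting then gives injectivity.\<close>

lemma complete_residue_set_iff_bij_betw:
  assumes "l > 0"
  shows "complete_residue_set l {g i |i. i < l} \<longleftrightarrow> bij_betw (\<lambda>i. g i mod l) {..<l} {..<l}"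
proof
  assume crs: "complete_residue_set l {g i |i. i < l}"
  have "{..<l} \<subseteq> (\<lambda>i. g i mod l) ` {..<l}"
  proof
    fix b assume "b \<in> {..<l}"
    obtain i where "i < l" "[int b = int (g i)] (mod int l)"
      using crs unfolding complete_residue_set_def by blast
    then have "b = g i mod l"
      using \<open>b \<in> {..<l}\<close> by (simp add: cong_int_iff) (simp add: cong_def)
    then show "b \<in> (\<lambda>i. g i mod l) ` {..<l}"
      using \<open>i < l\<close> by auto
  qed
  then show "bij_betw (\<lambda>i. g i mod l) {..<l} {..<l}"
    by (rule finite_covering_imp_bij_betw[OF finite_lessThan])
next
  assume bij: "bij_betw (\<lambda>i. g i mod l) {..<l} {..<l}"
  show "complete_residue_set l {g i |i. i < l}"
    unfolding complete_residue_set_def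
  proof
    fix a :: int
    define b where "b = nat (a mod int l)"
    have "b < l"
      using assms by (simp add: b_def nat_less_iff)
    have cong: "[a = int n] (mod int l) \<longleftrightarrow> n mod l = b" for n
      using assms unfolding b_def cong_def by (auto simp: nat_eq_iff simp flip: zmod_int)
    have "b \<in> (\<lambda>i. g i mod l) ` {..<l}"
      using bij \<open>b < l\<close> by (simp add: bij_betw_def)
    then obtain i where "i < l" "g i mod l = b"
      by auto
    moreover have "j = i" if "j < l" "g j mod l = b" for j
      using that bij \<open>i < l\<close> \<open>g i mod l = b\<close> by (auto simp: bij_betw_def inj_on_def)
    ultimately show "\<exists>!x. x \<in> {g i |i. i < l} \<and> [a = int x] (mod int l)"
      unfolding cong by blast
  qed
qed

section \<open>Subfields as root sets, and divisibility of a geometric sum\<close>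

lemma poly_in_subfield:
  assumes "is_subfield K" and "\<And>n. coeff p n \<in> K" and "x \<in> K"
  shows "poly p x \<in> K"
  using assms(2)
proof (induction p)
  case 0
  then show ?case
    using assms(1) by (simp add: is_subfield_def)
next
  case (pCons a p)
  have "a \<in> K" and "coeff p n \<in> K" for n
    using pCons.prems[of 0] pCons.prems[of "Suc n"] by simp_all
  then show ?case
    using pCons.IH assms by (simp add: is_subfield_def)
qed

text \<open>All \<open>n = card K - 1\<close> nonzero elements of \<open>K\<close> are roots of
  \<open>x ^ n - 1\<close>, which has at most \<open>n\<close> roots. One inclusion later puts the
  powers of \<open>\<zeta>\<close> into \<open>K\<close>, the other bounds the order of
  \<open>a i\<close>.\<close>

lemma subfield_eq_roots:
  fixes K :: "'a::{field, finite} set"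
  assumes "is_subfield K"
  shows "K - {0} = {x. x ^ (card K - 1) = 1}"
proof (rule card_seteq)
  define n where "n = card K - 1"
  have card: "card (K - {0}) = n"
    using assms by (simp add: is_subfield_def n_def)
  show "K - {0} \<subseteq> {x. x ^ n = 1}"
    using power_card_eq_1_of_mult_closed[of "K - {0}"] assms card by (auto simp: is_subfield_def)
  \<comment> \<open>This gives \<open>n > 0\<close>; for \<open>n = 0\<close> the polynomial
    \<open>p\<close> would vanish.\<close>
  have "1 \<in> K - {0}"
    using assms by (simp add: is_subfield_def)
  then have "n > 0"
    using card by (metis card_gt_0_iff empty_iff finite)
  define p where "p = monom (1::'a) n + [:-1:]"
  have "degree p = n"
    using \<open>n > 0\<close> unfolding p_def
    by (subst degree_add_eq_left) (simp_all add: degree_monom_eq)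
  moreover from this have "p \<noteq> 0"
    using \<open>n > 0\<close> by auto
  moreover have "poly p x = 0 \<longleftrightarrow> x ^ n = 1" for x
    by (simp add: p_def poly_monom)
  ultimately show "card {x::'a. x ^ n = 1} \<le> card (K - {0})"
    using card_poly_roots_bound[of p] card by simp
qed simp

lemma dvd_sum_powers:
  fixes a l m :: nat
  assumes "[a = 1] (mod l)" and "l dvd m"
  shows "l dvd (\<Sum>k<m. a ^ k)"
proof -
  have "[(\<Sum>k<m. a ^ k) = (\<Sum>k<m. 1)] (mod l)"
    using cong_pow[OF assms(1)] by (intro cong_sum) simp
  then show ?thesis
    using assms(2) by (simp add: cong_dvd_iff)
qed

section \<open>Reduction of \<open>P\<close> to a map of coset indices and power maps\<close>

theorem theorem3p4:
  fixes \<gamma> \<zeta> :: "'a::{field, finite}"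
    and K :: "'a set"
    and q q0 m l s :: nat
    and r :: "nat \<Rightarrow> nat"
    and f :: "nat \<Rightarrow> 'a poly"
    and P :: "'a \<Rightarrow> 'a"
  assumes "primepow q" and "primepow q0" and "m > 0"
    and "CARD('a) = q"
    and "is_subfield K" and "card K = q0"
    and "is_primitive_element \<gamma>"
    and "l > 0" and "\<forall>i<l. r i > 0"
    and "q - 1 = l * s"
    and "\<zeta> = \<gamma> ^ s"
    and "q = q0 ^ m" and "[q0 = 1] (mod l)" and "l dvd m"
    and "\<forall>i<l. \<forall>n. coeff (f i) n \<in> K"
    and "P 0 = 0"
    and "\<forall>i<l. \<forall>x\<in>cyclotomic_coset \<gamma> l s i. P x = x ^ r i * poly (f i) (x ^ s)"
  shows "bij P \<longleftrightarrow>
           complete_residue_set l {r i * i |i. i < l} \<and>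
           (\<forall>i<l. gcd (r i) s = 1 \<and> poly (f i) (\<zeta> ^ i) \<noteq> 0)"
proof -
  have card: "CARD('a) - 1 = l * s"
    using assms by simp
  have "s > 0"
    using card card_field_gt_1[where 'a='a] by (cases s) auto
  have \<gamma>: "is_primitive_element \<gamma>" and "\<gamma> \<noteq> 0"
    using assms primitive_element_nonzero by blast+
  have "\<zeta> \<noteq> 0"
    using \<open>\<gamma> \<noteq> 0\<close> assms by simp
  \<comment> \<open>The factor \<open>s\<close> cancels from the congruence modulo
    \<open>l * s\<close>, so \<open>\<zeta>\<close> has order exactly \<open>l\<close>.\<close>
  have \<zeta>_power_eq_iff: "\<zeta> ^ a = \<zeta> ^ b \<longleftrightarrow> [a = b] (mod l)" for a b
    using primitive_element_power_eq_iff[OF \<gamma>, of "s * a" "s * b"] card \<open>s > 0\<close>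
    by (simp add: \<open>\<zeta> = \<gamma> ^ s\<close> cong_def mult.commute[of l] flip: power_mult)
  have "q0 > 0"
    using \<open>primepow q0\<close> primepow_gt_0_nat by auto
  have "q - 1 = (q0 - 1) * (\<Sum>k<m. q0 ^ k)"
  proof -
    \<comment> \<open>The geometric sum is taken over the integers to avoid truncated
      subtraction.\<close>
    have "int q0 ^ m - 1 = (int q0 - 1) * (\<Sum>k<m. int q0 ^ k)"
      by (rule power_diff_1_eq)
    then have "int (q - 1) = int ((q0 - 1) * (\<Sum>k<m. q0 ^ k))"
      using \<open>q0 > 0\<close> \<open>q = q0 ^ m\<close> by (simp add: of_nat_diff Suc_le_eq)
    then show ?thesis
      by (simp only: of_nat_eq_iff)
  qed
  moreover obtain t where "(\<Sum>k<m. q0 ^ k) = l * t"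
    using dvd_sum_powers assms by (meson dvdE)
  \<comment> \<open>Cancelling \<open>l\<close> from \<open>l * s = (q0 - 1) * (l * t)\<close> shows
    that \<open>q0 - 1\<close> divides \<open>s\<close>.\<close>
  ultimately have s: "s = (q0 - 1) * t"
    using \<open>q - 1 = l * s\<close> \<open>l > 0\<close> by simp
  have "[q0 - 1 = 0] (mod l)"
    using \<open>[q0 = 1] (mod l)\<close> \<open>q0 > 0\<close>
    by (metis One_nat_def Suc_leI cong_0_iff cong_altdef_nat cong_sym)
  then have "\<zeta> ^ (q0 - 1) = 1"
    using \<zeta>_power_eq_iff[of "q0 - 1" 0] by simp
  then have "(\<zeta> ^ i) ^ (q0 - 1) = 1" for i
    by (metis mult.commute power_mult power_one)
  then have "\<zeta> ^ i \<in> K" for i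
    using subfield_eq_roots[OF \<open>is_subfield K\<close>] \<open>card K = q0\<close> by blast
  define a where "a i = poly (f i) (\<zeta> ^ i)" for i
  have a_power: "a i ^ s = 1" if "i < l" "a i \<noteq> 0" for i
  proof -
    have "a i \<in> K - {0}"
      using poly_in_subfield[OF \<open>is_subfield K\<close> _ \<open>\<zeta> ^ i \<in> K\<close>] that assms by (simp add: a_def)
    then have "a i ^ (q0 - 1) = 1"
      using subfield_eq_roots[OF \<open>is_subfield K\<close>] \<open>card K = q0\<close> by blast
    then show ?thesis
      by (simp add: s power_mult)
  qed
  have coset_iff: "x \<in> cyclotomic_coset \<gamma> l s i \<longleftrightarrow> x \<noteq> 0 \<and> x ^ s = \<zeta> ^ i" if "i < l" for x i
    using cyclotomic_coset_iff[OF \<gamma> card that] assms by simp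
  have P_coset: "P x = x ^ r i * a i" if "i < l" "x \<noteq> 0" "x ^ s = \<zeta> ^ i" for x i
    using that coset_iff assms by (simp add: a_def)
  have coset_cover: "\<exists>i<l. x ^ s = \<zeta> ^ i" if "x \<noteq> 0" for x
  proof -
    obtain n where "x = \<gamma> ^ n"
      using primitive_element_powers[OF \<gamma>] \<open>x \<noteq> 0\<close> by auto
    then have "x ^ s = \<zeta> ^ n"
      by (simp add: \<open>\<zeta> = \<gamma> ^ s\<close> mult.commute flip: power_mult)
    also have "\<dots> = \<zeta> ^ (n mod l)"
      by (simp add: \<zeta>_power_eq_iff)
    finally show ?thesis
      using \<open>l > 0\<close> by (intro exI[of _ "n mod l"]) simp
  qed
  have P_power: "P x ^ s = \<zeta> ^ (r i * i)" if "i < l" "a i \<noteq> 0" "x \<noteq> 0" "x ^ s = \<zeta> ^ i" for x i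
  proof -
    have "P x ^ s = (x ^ s) ^ r i * a i ^ s"
      by (simp add: P_coset[OF that(1,3,4)] power_mult_distrib mult.commute flip: power_mult)
    also have "\<dots> = (\<zeta> ^ i) ^ r i"
      by (simp only: that(4) a_power[OF that(1,2)] mult_1_right)
    finally show ?thesis
      by (simp add: mult.commute flip: power_mult)
  qed
  have crs_iff: "complete_residue_set l {r i * i |i. i < l} \<longleftrightarrow>
      bij_betw (\<lambda>i. r i * i mod l) {..<l} {..<l}"
    using \<open>l > 0\<close> by (rule complete_residue_set_iff_bij_betw)
  show ?thesis
    unfolding crs_iff a_def[symmetric]
  proof (intro iffI conjI allI impI)

    \<comment> \<open>Necessity of the three conditions\<close>
    assume "bij P"
    then have inj: "x = y" if "P x = P y" for x y
      using that by (auto dest: bij_is_inj injD)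
    have \<gamma>_power: "(\<gamma> ^ i) ^ s = \<zeta> ^ i" for i
      by (simp add: \<open>\<zeta> = \<gamma> ^ s\<close> mult.commute flip: power_mult)
    show a_nonzero: "a i \<noteq> 0" if "i < l" for i
    proof
      assume "a i = 0"
      \<comment> \<open>The coset representative \<open>\<gamma> ^ i\<close> would collide with
        \<open>0\<close>.\<close>
      then have "P (\<gamma> ^ i) = P 0"
        using P_coset[OF that _ \<gamma>_power] \<open>\<gamma> \<noteq> 0\<close> \<open>P 0 = 0\<close> by simp
      then show False
        using inj \<open>\<gamma> \<noteq> 0\<close> by fastforce
    qed
    show "gcd (r i) s = 1" if "i < l" for i
    proof -
      define d where "d = gcd (r i) s"
      obtain e where e: "s = d * e"
        unfolding d_def by (metis dvdE gcd_dvd2)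
      obtain k where k: "r i = d * k"
        unfolding d_def by (metis dvdE gcd_dvd1)
      \<comment> \<open>Since \<open>\<gamma>\<close> has order \<open>l * s = l * e * d\<close>,
        \<open>u\<close> has order \<open>d\<close>. As \<open>d\<close> divides both
        \<open>s\<close> and \<open>r i\<close>, multiplying by \<open>u\<close> preserves the coset
        and the value of \<open>P\<close>, so injectivity forces \<open>u = 1\<close> and hence
        \<open>d = 1\<close>.\<close>
      define u where "u = \<gamma> ^ (l * e)"
      have "\<gamma> ^ (l * s) = 1"
        using nonzero_field_power_card_diff_1[OF \<open>\<gamma> \<noteq> 0\<close>] card by simp
      then have "u ^ d = 1"
        by (simp add: u_def e mult_ac flip: power_mult)
      then have "u ^ s = 1" "u ^ r i = 1"
        by (simp_all add: e k power_mult)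
      moreover have "u \<noteq> 0"
        using \<open>\<gamma> \<noteq> 0\<close> by (simp add: u_def)
      ultimately have "P (\<gamma> ^ i * u) = P (\<gamma> ^ i)"
        using that \<open>\<gamma> \<noteq> 0\<close> by (simp add: P_coset \<gamma>_power power_mult_distrib)
      then have "u = 1"
        using inj \<open>\<gamma> \<noteq> 0\<close> by fastforce
      then have "[l * e = 0] (mod l * s)"
        using primitive_element_power_eq_iff[OF \<gamma>, of "l * e" 0] card by (simp add: u_def)
      then have "s dvd e"
        using \<open>l > 0\<close> by (simp add: cong_0_iff)
      then have "d = 1"
        using e \<open>s > 0\<close> by simp
      then show ?thesis
        by (simp add: d_def)
    qed
    have "{..<l} \<subseteq> (\<lambda>i. r i * i mod l) ` {..<l}"
    proof
      fix b assume "b \<in> {..<l}"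
      \<comment> \<open>The value \<open>\<gamma> ^ b\<close> lies in the coset of index
        \<open>b\<close>, so the coset index of its preimage is sent to \<open>b\<close>.\<close>
      obtain x where x: "P x = \<gamma> ^ b"
        using \<open>bij P\<close> by (metis bij_pointE)
      then have "x \<noteq> 0"
        using \<open>P 0 = 0\<close> \<open>\<gamma> \<noteq> 0\<close> by (metis power_not_zero)
      then obtain i where i: "i < l" "x ^ s = \<zeta> ^ i"
        using coset_cover by blast
      have "\<zeta> ^ b = \<zeta> ^ (r i * i)"
        using P_power[OF i(1) a_nonzero[OF i(1)] \<open>x \<noteq> 0\<close> i(2)] x \<gamma>_power by simp
      then have "b = r i * i mod l"
        using \<open>b \<in> {..<l}\<close> by (simp add: \<zeta>_power_eq_iff cong_def)
      then show "b \<in> (\<lambda>i. r i * i mod l) ` {..<l}"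
        using i by auto
    qed
    then show "bij_betw (\<lambda>i. r i * i mod l) {..<l} {..<l}"
      by (rule finite_covering_imp_bij_betw[OF finite_lessThan])
  next

    \<comment> \<open>Sufficiency of the three conditions\<close>
    assume "bij_betw (\<lambda>i. r i * i mod l) {..<l} {..<l} \<and> (\<forall>i<l. gcd (r i) s = 1 \<and> a i \<noteq> 0)"
    then have inj_r: "inj_on (\<lambda>i. r i * i mod l) {..<l}"
      and cop: "\<And>i. i < l \<Longrightarrow> coprime (r i) s" and a_nonzero: "\<And>i. i < l \<Longrightarrow> a i \<noteq> 0"
      by (auto simp: bij_betw_def coprime_iff_gcd_eq_1)
    have "P x \<noteq> 0" if "x \<noteq> 0" for x
    proof -
      obtain i where "i < l" "x ^ s = \<zeta> ^ i"
        using coset_cover[OF \<open>x \<noteq> 0\<close>] by blast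
      then show ?thesis
        using P_coset[OF \<open>i < l\<close> that] a_nonzero[OF \<open>i < l\<close>] that by simp
    qed
    then have P_eq_0_iff: "P x = 0 \<longleftrightarrow> x = 0" for x
      using \<open>P 0 = 0\<close> by blast
    have "x = y" if eq: "P x = P y" for x y
    proof (cases "x = 0")
      case True
      then show ?thesis
        using P_eq_0_iff eq by metis
    next
      case False
      then have "y \<noteq> 0"
        using P_eq_0_iff eq by metis
      obtain i where i: "i < l" "x ^ s = \<zeta> ^ i"
        using coset_cover False by blast
      obtain j where j: "j < l" "y ^ s = \<zeta> ^ j"
        using coset_cover \<open>y \<noteq> 0\<close> by blast
      \<comment> \<open>Comparing \<open>s\<close>-th powers of the equal values identifies the two
        cosets.\<close>
      have "\<zeta> ^ (r i * i) = \<zeta> ^ (r j * j)"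
        using P_power[OF i(1) a_nonzero[OF i(1)] False i(2)] eq
          P_power[OF j(1) a_nonzero[OF j(1)] \<open>y \<noteq> 0\<close> j(2)] by simp
      then have "j = i"
        using inj_onD[OF inj_r, of j i] i(1) j(1) by (simp add: \<zeta>_power_eq_iff cong_def)
      \<comment> \<open>On a common coset the nonzero constant \<open>a i\<close> cancels; the order
        of \<open>x / y\<close> then divides both \<open>r i\<close> and \<open>s\<close>, which are
        coprime.\<close>
      have "(x / y) ^ r i = 1"
        using eq P_coset[OF i(1) False i(2)] P_coset[OF j(1) \<open>y \<noteq> 0\<close> j(2)] \<open>y \<noteq> 0\<close>
          a_nonzero[OF i(1)]
        by (simp add: \<open>j = i\<close> power_divide)
      moreover have "(x / y) ^ s = 1"
        using i(2) j(2) \<open>\<zeta> \<noteq> 0\<close> by (simp add: \<open>j = i\<close> power_divide)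
      ultimately have "x / y = 1"
        using cop[OF i(1)] i(1) \<open>\<forall>i<l. r i > 0\<close> by (metis coprime_power_eq_1)
      then show ?thesis
        by simp
    qed
    then show "bij P"
      by (simp add: bij_def inj_def finite_UNIV_inj_surj)
  qed
qed

end
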